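(* (a) $\eta_{\mathbb{R}}(\mathbb{R})$ and $\eta_{\mathbb{C}}(\mathbb{C})$ are homeomorphic. (b) $\theta\mathbb{R}$ and $\theta\mathbb{C}$ are homeomorphic.
   Context: Let $\mathbb{K}$ be $\mathbb{R}$ or $\mathbb{C}$ with its usual topology. $\mathcal{D}(\mathbb{K})$ is the collection of all closed discrete subsets of $\mathbb{K}$ together with the special member $\mathbb{K}$ itself. A discrete $z$-filter on $\mathbb{K}$ is a collection $\mathcal{F}$ of members of $\mathcal{D}(\mathbb{K})$ such that $\emptyset\notin\mathcal{F}$; $D_1,D_2\in\mathcal{F}$ implies $D_1\cap D_2\in\mathcal{F}$; and $D_1\in\mathcal{F}$, $D\in\mathcal{D}(\mathbb{K})$, $D_1\subseteq D$ imply $D\in\mathcal{F}$. A discrete $z$-ultrafilter is a discrete $z$-filter that is maximal under inclusion. $\theta\mathbb{K}$ is the set of all discrete $z$-ultrafilters on $\mathbb{K}$, regarded as an index set: $\mathcal{D}^p$ is the discrete $z$-ultrafilter corresponding to the point $p\in\theta\mathbb{K}$. It is topologized by taking as basic closed sets the sets $\overline{Z}=\{p\in\theta\mathbb{K}: Z\in\mathcal{D}^p\}$, for $Z$ a closed discrete subset of $\mathbb{K}$. The map $\eta_{\mathbb{K}}:\mathbb{K}\to\theta\mathbb{K}$ sends $a\in\mathbb{K}$ to the point given by the discrete $z$-ultrafilter $\mathcal{D}_a$ fixed at $a$ (all of whose members contain $a$), and $\eta_{\mathbb{K}}(\mathbb{K})$ has the subspace topology of $\theta\mathbb{K}$. 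*)

theory Defs
  imports "HOL-Analysis.Analysis"
begin

definition closed_discrete :: "'a::topological_space set \<Rightarrow> bool" where
  "closed_discrete Z \<longleftrightarrow> closed Z \<and> discrete Z"

definition \<D> :: "'a::topological_space set set" where
  "\<D> = insert UNIV {Z. closed_discrete Z}"

definition discrete_z_filter :: "'a::topological_space set set \<Rightarrow> bool" where
  "discrete_z_filter F \<longleftrightarrow>
     F \<subseteq> \<D> \<and> {} \<notin> F \<and>
     (\<forall>D\<^sub>1\<in>F. \<forall>D\<^sub>2\<in>F. D\<^sub>1 \<inter> D\<^sub>2 \<in> F) \<and>
     (\<forall>D\<^sub>1\<in>F. \<forall>D\<in>\<D>. D\<^sub>1 \<subseteq> D \<longrightarrow> D \<in> F)"

definition discrete_z_ultrafilter :: "'a::topological_space set set \<Rightarrow> bool" where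
  "discrete_z_ultrafilter F \<longleftrightarrow>
     discrete_z_filter F \<and> (\<forall>G. discrete_z_filter G \<and> F \<subseteq> G \<longrightarrow> G = F)"

text \<open>A point \<open>p\<close> is identified with its discrete z-ultrafilter \<open>\<D>\<^sup>p\<close>.\<close>

definition \<theta> :: "'a::topological_space set set set" where
  "\<theta> = {p. discrete_z_ultrafilter p}"

definition basic_closed :: "'a::topological_space set \<Rightarrow> 'a set set set" where
  "basic_closed Z = {p \<in> \<theta>. Z \<in> p}"

text \<open>The complements of the basic closed sets form a base of open sets. That this is a
  legitimate base, so that the closed sets are exactly the intersections of basic closed sets,
  is checked in \<open>istopology_theta\<close> and \<open>closedin_theta_topology\<close> below.\<close>

definition theta_topology :: "'a::topological_space set set topology" where
  "theta_topology =
     topology (arbitrary union_of (\<lambda>U. \<exists>Z. closed_discrete Z \<and> U = \<theta> - basic_closed Z))"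

definition \<eta> :: "'a::topological_space \<Rightarrow> 'a set set" where
  "\<eta> a = {D \<in> \<D>. a \<in> D}"

lemma closed_discrete_iff: "closed_discrete Z \<longleftrightarrow> (\<forall>x. \<not> x islimpt Z)"
  unfolding closed_discrete_def discrete_def isolated_in_islimpt_iff closed_limpt by blast

lemma closed_discrete_Un:
  "closed_discrete Y \<Longrightarrow> closed_discrete Z \<Longrightarrow> closed_discrete (Y \<union> Z)"
  by (simp add: closed_discrete_iff islimpt_Un)

lemma closed_discrete_subset: "closed_discrete Z \<Longrightarrow> Y \<subseteq> Z \<Longrightarrow> closed_discrete Y"
  unfolding closed_discrete_iff by (blast intro: islimpt_subset)

lemma \<D>_Int: "D \<in> \<D> \<Longrightarrow> E \<in> \<D> \<Longrightarrow> D \<inter> E \<in> \<D>"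
  unfolding \<D>_def by (auto intro: closed_discrete_subset)

lemma ultrafilter_meets:
  assumes F: "discrete_z_ultrafilter F" and Z: "Z \<in> \<D>" and meet: "\<And>D. D \<in> F \<Longrightarrow> D \<inter> Z \<noteq> {}"
    and ne: "F \<noteq> {}"
  shows "Z \<in> F"
proof -
  have fil: "F \<subseteq> \<D>" "\<And>D E. D \<in> F \<Longrightarrow> E \<in> F \<Longrightarrow> D \<inter> E \<in> F"
    using F unfolding discrete_z_ultrafilter_def discrete_z_filter_def by auto
  define G where "G = {E \<in> \<D>. \<exists>D\<in>F. D \<inter> Z \<subseteq> E}"
  have "discrete_z_filter G"
    unfolding discrete_z_filter_def
  proof (intro conjI ballI impI)
    show "{} \<notin> G" using meet by (auto simp: G_def)
    fix D E assume "D \<in> G" "E \<in> G"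
    then obtain A B where "A \<in> F" "B \<in> F" "A \<inter> Z \<subseteq> D" "B \<inter> Z \<subseteq> E" "D \<in> \<D>" "E \<in> \<D>"
      by (auto simp: G_def)
    then show "D \<inter> E \<in> G"
      unfolding G_def using fil(2)[of A B] by (auto intro!: \<D>_Int bexI[of _ "A \<inter> B"])
  qed (auto simp: G_def)
  moreover have "F \<subseteq> G" using fil(1) by (auto simp: G_def)
  ultimately have "G = F" using F by (auto simp: discrete_z_ultrafilter_def)
  moreover have "Z \<in> G" using ne Z by (auto simp: G_def)
  ultimately show ?thesis by simp
qed

lemma ultrafilter_UNIV:
  assumes F: "discrete_z_ultrafilter (F :: 'a::topological_space set set)"
  shows "UNIV \<in> F"
proof (cases "F = {}")
  case True
  have "discrete_z_filter {UNIV :: 'a set}"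
    by (auto simp: discrete_z_filter_def \<D>_def)
  with F True show ?thesis by (auto simp: discrete_z_ultrafilter_def)
next
  case False
  then obtain D where "D \<in> F" by blast
  moreover have "\<forall>D\<in>F. \<forall>E\<in>\<D>. D \<subseteq> E \<longrightarrow> E \<in> F"
    using F by (simp add: discrete_z_ultrafilter_def discrete_z_filter_def)
  ultimately show ?thesis by (auto simp: \<D>_def)
qed

lemma basic_closed_Un:
  assumes Y: "closed_discrete Y" and Z: "closed_discrete Z"
  shows "basic_closed (Y \<union> Z) = basic_closed Y \<union> basic_closed Z"
proof -
  have mem: "Y \<in> \<D>" "Z \<in> \<D>" "Y \<union> Z \<in> \<D>"
    using Y Z closed_discrete_Un by (auto simp: \<D>_def)
  have "Y \<union> Z \<in> p \<longleftrightarrow> Y \<in> p \<or> Z \<in> p" if p: "discrete_z_ultrafilter p" for p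
  proof
    have fil: "\<And>D E. D \<in> p \<Longrightarrow> E \<in> p \<Longrightarrow> D \<inter> E \<in> p"
       "\<And>D E. D \<in> p \<Longrightarrow> E \<in> \<D> \<Longrightarrow> D \<subseteq> E \<Longrightarrow> E \<in> p"
      using p unfolding discrete_z_ultrafilter_def discrete_z_filter_def by blast+
    show "Y \<union> Z \<in> p" if "Y \<in> p \<or> Z \<in> p" using that fil(2) mem by blast
    assume un: "Y \<union> Z \<in> p"
    show "Y \<in> p \<or> Z \<in> p"
    proof (rule ccontr)
      assume n: "\<not> (Y \<in> p \<or> Z \<in> p)"
      then obtain D where D: "D \<in> p" "D \<inter> Y = {}"
        using ultrafilter_meets[OF p mem(1)] un by blast
      have "D \<inter> (Y \<union> Z) \<in> p" using D un fil(1) by blast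
      moreover have "D \<inter> (Y \<union> Z) \<subseteq> Z" using D by blast
      ultimately show False using fil(2) mem n by blast
    qed
  qed
  then show ?thesis by (auto simp: basic_closed_def \<theta>_def)
qed

lemma istopology_theta:
  "istopology (arbitrary union_of
     (\<lambda>U. \<exists>Z. closed_discrete Z \<and> U = (\<theta> :: 'a::topological_space set set set) - basic_closed Z))"
proof (rule istopology_base)
  fix S T :: "'a set set set"
  assume "\<exists>Z. closed_discrete Z \<and> S = \<theta> - basic_closed Z"
    and "\<exists>Z. closed_discrete Z \<and> T = \<theta> - basic_closed Z"
  then obtain Y Z where "closed_discrete Y" "closed_discrete Z"
    "S = \<theta> - basic_closed Y" "T = \<theta> - basic_closed Z" by blast
  then show "\<exists>Z. closed_discrete Z \<and> S \<inter> T = \<theta> - basic_closed Z"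
    by (intro exI[of _ "Y \<union> Z"]) (auto simp: closed_discrete_Un basic_closed_Un)
qed

lemma openin_theta_topology:
  "openin theta_topology U \<longleftrightarrow>
     (\<exists>\<Z>. (\<forall>Z\<in>\<Z>. closed_discrete Z) \<and> U = (\<Union>Z\<in>\<Z>. \<theta> - basic_closed Z))"
  (is "_ \<longleftrightarrow> ?R")
proof -
  have "openin theta_topology U \<longleftrightarrow>
    (arbitrary union_of (\<lambda>U. \<exists>Z. closed_discrete Z \<and> U = \<theta> - basic_closed Z)) U"
    unfolding theta_topology_def by (subst topology_inverse'[OF istopology_theta]) (rule refl)
  also have "\<dots> \<longleftrightarrow> ?R"
  proof
    assume "(arbitrary union_of (\<lambda>U. \<exists>Z. closed_discrete Z \<and> U = \<theta> - basic_closed Z)) U"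
    then obtain \<U> where U: "\<forall>V\<in>\<U>. \<exists>Z. closed_discrete Z \<and> V = \<theta> - basic_closed Z" "\<Union>\<U> = U"
      unfolding union_of_def arbitrary_def by auto
    from bchoice[OF U(1)] obtain z
      where z: "\<forall>V\<in>\<U>. closed_discrete (z V) \<and> V = \<theta> - basic_closed (z V)" ..
    have "U = (\<Union>Z\<in>z ` \<U>. \<theta> - basic_closed Z)"
      unfolding U(2)[symmetric] image_image using z by (metis (no_types, lifting) SUP_cong image_ident)
    with z show ?R by (intro exI[of _ "z ` \<U>"]) simp
  next
    assume ?R
    then obtain \<Z> where Z: "\<forall>Z\<in>\<Z>. closed_discrete Z" "U = (\<Union>Z\<in>\<Z>. \<theta> - basic_closed Z)" by blast
    then show "(arbitrary union_of (\<lambda>U. \<exists>Z. closed_discrete Z \<and> U = \<theta> - basic_closed Z)) U"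
      unfolding union_of_def arbitrary_def
      by (intro exI[of _ "(\<lambda>Z. \<theta> - basic_closed Z) ` \<Z>"]) auto
  qed
  finally show ?thesis .
qed

lemma topspace_theta_topology [simp]: "topspace theta_topology = \<theta>"
proof
  show "topspace theta_topology \<subseteq> \<theta>"
    unfolding topspace_def openin_theta_topology by auto
  have "\<theta> - basic_closed {} = \<theta>"
    by (auto simp: basic_closed_def \<theta>_def discrete_z_ultrafilter_def discrete_z_filter_def)
  then have "openin theta_topology \<theta>"
    unfolding openin_theta_topology
    by (intro exI[of _ "{{}}"]) (auto simp: closed_discrete_def)
  then show "\<theta> \<subseteq> topspace theta_topology" by (rule openin_subset)
qed

lemma closedin_theta_topology:
  "closedin theta_topology C \<longleftrightarrow>
     (\<exists>\<Z>. (\<forall>Z\<in>\<Z>. closed_discrete Z) \<and> C = \<theta> \<inter> (\<Inter>Z\<in>\<Z>. basic_closed Z))"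
  (is "_ \<longleftrightarrow> ?R")
proof
  assume "closedin theta_topology C"
  then have C: "C \<subseteq> \<theta>" "openin theta_topology (\<theta> - C)" by (auto simp: closedin_def)
  then obtain \<Z> where "\<forall>Z\<in>\<Z>. closed_discrete Z" "\<theta> - C = (\<Union>Z\<in>\<Z>. \<theta> - basic_closed Z)"
    unfolding openin_theta_topology by blast
  with C(1) show ?R by (intro exI[of _ \<Z>]) blast
next
  assume ?R
  then obtain \<Z> where Z: "\<forall>Z\<in>\<Z>. closed_discrete Z" "C = \<theta> \<inter> (\<Inter>Z\<in>\<Z>. basic_closed Z)" by blast
  then have "\<theta> - C = (\<Union>Z\<in>\<Z>. \<theta> - basic_closed Z)" by blast
  with Z show "closedin theta_topology C"
    by (auto simp: closedin_def openin_theta_topology)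
qed

lemma \<eta>_in_\<theta>: "\<eta> a \<in> \<theta>" for a :: "'a::t1_space"
proof -
  have fil: "discrete_z_filter (\<eta> a)"
    unfolding discrete_z_filter_def \<eta>_def using \<D>_Int by auto
  have "G = \<eta> a" if G: "discrete_z_filter G" "\<eta> a \<subseteq> G" for G
  proof
    have "closed_discrete {a}"
      by (auto simp: closed_discrete_iff islimpt_finite)
    then have "{a} \<in> G" using G(2) by (auto simp: \<eta>_def \<D>_def)
    have sub: "G \<subseteq> \<D>" and ne: "{} \<notin> G"
      and int: "D \<inter> {a} \<in> G" if "D \<in> G" for D
      using G(1) that \<open>{a} \<in> G\<close> by (simp_all add: discrete_z_filter_def)
    show "G \<subseteq> \<eta> a"
    proof
      fix D assume D: "D \<in> G"
      with int[OF D] ne have "a \<in> D" by (cases "a \<in> D") simp_all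
      with D sub show "D \<in> \<eta> a" by (auto simp: \<eta>_def)
    qed
  qed (use G in auto)
  with fil show ?thesis by (auto simp: \<theta>_def discrete_z_ultrafilter_def)
qed

end

theory Submission
  imports Defs
begin

text \<open>
  The space \<open>\<theta>\<close> is built from the closed discrete sets alone: they determine \<open>\<D>\<close>, the filters,
  the ultrafilters and the basic closed sets. Hence a bijection that carries closed discrete sets
  to closed discrete sets in both directions induces a homeomorphism of the spaces \<open>\<theta>\<close> by taking
  images, however discontinuous it may be. The induced map sends \<open>\<eta> a\<close> to \<open>\<eta> (f a)\<close>, so it
  restricts to a homeomorphism between the copies of the underlying sets; this gives both parts at
  once (\<open>theta_homeomorphic\<close>).

  It remains to find such a bijection between the real line and the complex plane. In a normed
  space with the Heine-Borel property a set is closed and discrete exactly when it meets every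
  bounded set in a finite set. This is the same as meeting each shell
  \<open>n \<le> norm x < n + 1\<close> in a finite set (\<open>closed_discrete_iff_finite_shells\<close>), since finitely many
  shells cover a bounded set. Every shell of the line and of the plane has the cardinality of the
  continuum (\<open>shell_eqpoll_real\<close>). Choosing an arbitrary bijection from the \<open>n\<close>-th shell of the
  line to the \<open>n\<close>-th shell of the plane for every \<open>n\<close>, and gluing, gives the required map.
\<close>

section \<open>Bijections that respect closed discrete sets\<close>

text \<open>The inverse is kept as a parameter to make the notion visibly symmetric: each fact below is
  shown in one direction and then used for both \<open>f\<close> and \<open>g\<close>.\<close>

locale closed_discrete_iso =
  fixes f :: "'a::topological_space \<Rightarrow> 'b::topological_space" and g :: "'b \<Rightarrow> 'a"
  assumes gf [simp]: "g (f x) = x"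
    and fg [simp]: "f (g y) = y"
    and closed_discrete_f: "closed_discrete Z \<Longrightarrow> closed_discrete (f ` Z)"
    and closed_discrete_g: "closed_discrete Y \<Longrightarrow> closed_discrete (g ` Y)"
begin

lemma inverse: "closed_discrete_iso g f"
  by unfold_locales (simp_all add: closed_discrete_f closed_discrete_g)

lemma image_g_image_f [simp]: "g ` f ` Z = Z"
  by (simp add: image_image)

lemma image_f_image_g [simp]: "f ` g ` Y = Y"
  by (simp add: image_image)

lemma mem_push_iff: "Y \<in> (`) f ` F \<longleftrightarrow> g ` Y \<in> F"
  by (metis image_f_image_g image_g_image_f image_iff)

lemma push_pull [simp]: "(`) f ` (`) g ` G = G"
  by (simp add: image_image)

lemma \<D>_image: "D \<in> \<D> \<Longrightarrow> f ` D \<in> \<D>"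
  using closed_discrete_f surjI[of f g] by (auto simp: \<D>_def)

lemma discrete_z_filter_push:
  assumes "discrete_z_filter F"
  shows "discrete_z_filter ((`) f ` F)"
proof -
  have F: "F \<subseteq> \<D>" "{} \<notin> F" "\<And>D E. D \<in> F \<Longrightarrow> E \<in> F \<Longrightarrow> D \<inter> E \<in> F"
    "\<And>D E. D \<in> F \<Longrightarrow> E \<in> \<D> \<Longrightarrow> D \<subseteq> E \<Longrightarrow> E \<in> F"
    using assms by (simp_all add: discrete_z_filter_def)
  show ?thesis
    unfolding discrete_z_filter_def
  proof (intro conjI ballI impI)
    show "(`) f ` F \<subseteq> \<D>" using F(1) \<D>_image by blast
    show "{} \<notin> (`) f ` F" using F(2) by (simp add: mem_push_iff)
  next
    fix D E assume "D \<in> (`) f ` F" "E \<in> (`) f ` F"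
    then have "g ` D \<inter> g ` E \<in> F" using F(3) by (simp add: mem_push_iff)
    moreover have "g ` D \<inter> g ` E = g ` (D \<inter> E)"
      by (rule image_Int[symmetric], rule inj_on_inverseI[of _ f]) simp
    ultimately show "D \<inter> E \<in> (`) f ` F" by (simp add: mem_push_iff)
  next
    fix D E :: "'b set" assume "D \<in> (`) f ` F" "E \<in> \<D>" "D \<subseteq> E"
    then show "E \<in> (`) f ` F"
      using F(4)[of "g ` D" "g ` E"] closed_discrete_iso.\<D>_image[OF inverse]
      by (simp add: mem_push_iff image_mono)
  qed
qed

text \<open>Maximality is preserved because a filter above the pushed forward one pulls back along \<open>g\<close>
  to a filter above the original one.\<close>

lemma push_in_\<theta>:
  assumes "p \<in> \<theta>"
  shows "(`) f ` p \<in> \<theta>"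
proof -
  have p: "discrete_z_filter p" "\<And>G. discrete_z_filter G \<Longrightarrow> p \<subseteq> G \<Longrightarrow> G = p"
    using assms by (auto simp: \<theta>_def discrete_z_ultrafilter_def)
  have "G = (`) f ` p" if G: "discrete_z_filter G" "(`) f ` p \<subseteq> G" for G
  proof -
    have "p \<subseteq> (`) g ` G"
      using image_mono[OF G(2), of "(`) g"] closed_discrete_iso.push_pull[OF inverse] by simp
    then have "(`) g ` G = p"
      by (rule p(2)[OF closed_discrete_iso.discrete_z_filter_push[OF inverse G(1)]])
    then show ?thesis using push_pull[of G] by simp
  qed
  then show ?thesis
    using discrete_z_filter_push[OF p(1)] by (auto simp: \<theta>_def discrete_z_ultrafilter_def)
qed

lemma push_\<eta>: "(`) f ` \<eta> a = \<eta> (f a)"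
proof (intro set_eqI)
  fix Y
  have "g ` Y \<in> \<D> \<longleftrightarrow> Y \<in> \<D>"
    using \<D>_image[of "g ` Y"] closed_discrete_iso.\<D>_image[OF inverse, of Y] by auto
  moreover have "a \<in> g ` Y \<longleftrightarrow> f a \<in> Y" by (metis fg gf image_iff)
  ultimately show "Y \<in> (`) f ` \<eta> a \<longleftrightarrow> Y \<in> \<eta> (f a)"
    by (simp add: mem_push_iff \<eta>_def)
qed

lemma continuous_map_push: "continuous_map theta_topology theta_topology ((`) ((`) f))"
  unfolding continuous_map_closedin topspace_theta_topology
proof (intro conjI allI impI)
  show "(`) ((`) f) \<in> \<theta> \<rightarrow> \<theta>" using push_in_\<theta> by blast
next
  fix C :: "'b set set set" assume "closedin theta_topology C"
  then obtain \<Z> where Z: "\<forall>Z\<in>\<Z>. closed_discrete Z" "C = \<theta> \<inter> (\<Inter>Z\<in>\<Z>. basic_closed Z)"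
    unfolding closedin_theta_topology by blast
  \<comment> \<open>The preimage of the basic closed set of \<open>Z\<close> is the basic closed set of \<open>g ` Z\<close>.\<close>
  have "{p \<in> \<theta>. (`) f ` p \<in> C} = \<theta> \<inter> (\<Inter>Z\<in>(`) g ` \<Z>. basic_closed Z)"
    using push_in_\<theta> by (auto simp: Z(2) basic_closed_def mem_push_iff)
  then show "closedin theta_topology {p \<in> \<theta>. (`) f ` p \<in> C}"
    unfolding closedin_theta_topology using Z(1) closed_discrete_g
    by (intro exI[of _ "(`) g ` \<Z>"]) auto
qed

lemma homeomorphic_maps_push:
  "homeomorphic_maps theta_topology theta_topology ((`) ((`) f)) ((`) ((`) g))"
  unfolding homeomorphic_maps_def
  using continuous_map_push closed_discrete_iso.continuous_map_push[OF inverse]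
    closed_discrete_iso.push_pull[OF inverse]
  by simp

lemma theta_homeomorphic:
  "(theta_topology :: 'a set set topology) homeomorphic_space
     (theta_topology :: 'b set set topology)"
  using homeomorphic_maps_push unfolding homeomorphic_space_def by blast

lemma range_\<eta>_homeomorphic:
  "subtopology theta_topology (range (\<eta> :: 'a \<Rightarrow> 'a set set)) homeomorphic_space
     subtopology theta_topology (range (\<eta> :: 'b \<Rightarrow> 'b set set))"
proof -
  have "homeomorphic_maps (subtopology theta_topology (range (\<eta> :: 'a \<Rightarrow> 'a set set)))
      (subtopology theta_topology (range (\<eta> :: 'b \<Rightarrow> 'b set set)))
      ((`) ((`) f)) ((`) ((`) g))"
    by (rule homeomorphic_maps_subtopologies_alt[OF homeomorphic_maps_push])
      (auto simp: push_\<eta> closed_discrete_iso.push_\<eta>[OF inverse])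
  then show ?thesis unfolding homeomorphic_space_def by blast
qed

end

section \<open>Shells\<close>

definition shell :: "nat \<Rightarrow> 'a::real_normed_vector set" where
  "shell n = {x. nat \<lfloor>norm x\<rfloor> = n}"

lemma closed_discrete_iff_finite_shells:
  fixes Z :: "'a::{real_normed_vector, heine_borel} set"
  shows "closed_discrete Z \<longleftrightarrow> (\<forall>n. finite (Z \<inter> shell n))"
proof
  assume Z: "closed_discrete Z"
  show "\<forall>n. finite (Z \<inter> shell n)"
  proof (rule allI, rule ccontr)
    fix n assume inf: "infinite (Z \<inter> shell n)"
    have "norm x \<le> real n + 1" if "x \<in> shell n" for x :: 'a
      using that unfolding shell_def by simp linarith
    then have "bounded (Z \<inter> shell n)" by (auto simp: bounded_iff)
    with inf obtain x where "x islimpt (Z \<inter> shell n)"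
      using bounded_infinite_imp_islimpt by blast
    then have "x islimpt Z" by (rule islimpt_subset) simp
    with Z show False by (simp add: closed_discrete_iff)
  qed
next
  assume fin: "\<forall>n. finite (Z \<inter> shell n)"
  have "\<not> x islimpt Z" for x
  proof -
    \<comment> \<open>The unit ball around \<open>x\<close> lies in the first few shells.\<close>
    have "nat \<lfloor>norm y\<rfloor> \<le> nat \<lfloor>norm x + 1\<rfloor>" if "y \<in> ball x 1" for y
    proof (intro nat_mono floor_mono)
      show "norm y \<le> norm x + 1"
        using that norm_triangle_ineq2[of y x] by (simp add: dist_norm norm_minus_commute)
    qed
    then have "Z \<inter> ball x 1 \<subseteq> (\<Union>n\<le>nat \<lfloor>norm x + 1\<rfloor>. Z \<inter> shell n)"
      by (auto simp: shell_def)
    then have "finite (Z \<inter> ball x 1)" by (rule finite_subset) (intro finite_UN_I finite_atMost fin[rule_format])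
    then show ?thesis unfolding islimpt_eq_infinite_ball by (metis zero_less_one)
  qed
  then show "closed_discrete Z" by (simp add: closed_discrete_iff)
qed

text \<open>A shell contains a radial segment, whose points already number the continuum; the bound on
  the whole space supplies the other half of a Schroeder-Bernstein argument.\<close>

lemma shell_eqpoll_real:
  assumes "(UNIV :: 'a::real_normed_algebra_1 set) \<lesssim> (UNIV :: real set)"
  shows "(shell n :: 'a set) \<approx> (UNIV :: real set)"
proof (rule lepoll_antisym)
  show "(shell n :: 'a set) \<lesssim> (UNIV :: real set)"
    using assms by (meson lepoll_trans subset_imp_lepoll subset_UNIV)
  have "(UNIV :: real set) \<lesssim> {real n<..<real n + 1}"
    by (simp add: open_interval_eqpoll_reals eqpoll_imp_lepoll eqpoll_sym)
  also have "{real n<..<real n + 1} \<lesssim> (shell n :: 'a set)"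
    unfolding lepoll_def
  proof (intro exI conjI)
    show "inj_on (of_real :: real \<Rightarrow> 'a) {real n<..<real n + 1}" by (simp add: inj_on_def)
    show "(of_real :: real \<Rightarrow> 'a) ` {real n<..<real n + 1} \<subseteq> shell n"
      by (auto simp: shell_def) linarith
  qed
  finally show "(UNIV :: real set) \<lesssim> (shell n :: 'a set)" .
qed

lemma complex_lepoll_real: "(UNIV :: complex set) \<lesssim> (UNIV :: real set)"
proof -
  have "(UNIV :: complex set) \<lesssim> (UNIV :: real set) \<times> (UNIV :: real set)"
    unfolding lepoll_def
    by (intro exI[of _ "\<lambda>z. (Re z, Im z)"]) (auto simp: inj_on_def complex_eq_iff)
  also have "(UNIV :: real set) \<times> (UNIV :: real set) \<approx> (UNIV :: real set)"
    unfolding eqpoll_iff_card_of_ordIso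
    by (rule card_of_Times_same_infinite) (rule infinite_UNIV_char_0)
  finally show ?thesis .
qed

text \<open>Choosing a bijection on every shell and gluing them yields a bijection of the whole spaces,
  because the shells partition each space.\<close>

lemma closed_discrete_iso_of_shells:
  assumes "\<And>n. (shell n :: 'a::{real_normed_vector, heine_borel} set) \<approx>
    (shell n :: 'b::{real_normed_vector, heine_borel} set)"
  shows "\<exists>(f :: 'a \<Rightarrow> 'b) g. closed_discrete_iso f g"
proof -
  have "\<forall>n. \<exists>(h :: 'a \<Rightarrow> 'b) k. h ` shell n \<subseteq> shell n \<and> k ` shell n \<subseteq> shell n \<and>
    (\<forall>x\<in>shell n. k (h x) = x) \<and> (\<forall>y\<in>shell n. h (k y) = y)"
    using assms unfolding eqpoll_iff_bijections by (metis image_subsetI)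
  then obtain h :: "nat \<Rightarrow> 'a \<Rightarrow> 'b" and k where
    hk: "\<And>n. h n ` shell n \<subseteq> shell n" "\<And>n. k n ` shell n \<subseteq> shell n"
      "\<And>n x. x \<in> shell n \<Longrightarrow> k n (h n x) = x" "\<And>n y. y \<in> shell n \<Longrightarrow> h n (k n y) = y"
    by metis
  define f where "f x = h (nat \<lfloor>norm x\<rfloor>) x" for x
  define g where "g y = k (nat \<lfloor>norm y\<rfloor>) y" for y
  have f: "nat \<lfloor>norm (f x)\<rfloor> = nat \<lfloor>norm x\<rfloor>" for x
    using hk(1)[of "nat \<lfloor>norm x\<rfloor>"] by (auto simp: f_def shell_def)
  have g: "nat \<lfloor>norm (g y)\<rfloor> = nat \<lfloor>norm y\<rfloor>" for y
    using hk(2)[of "nat \<lfloor>norm y\<rfloor>"] by (auto simp: g_def shell_def)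
  have "f ` Z \<inter> shell n = f ` (Z \<inter> shell n)" "g ` Y \<inter> shell n = g ` (Y \<inter> shell n)" for Z Y n
    by (auto simp: shell_def f g)
  moreover have "g (f x) = x" for x
    unfolding g_def f unfolding f_def by (rule hk(3)) (simp add: shell_def)
  moreover have "f (g y) = y" for y
    unfolding f_def g unfolding g_def by (rule hk(4)) (simp add: shell_def)
  ultimately have "closed_discrete_iso f g"
    by unfold_locales (simp_all add: closed_discrete_iff_finite_shells)
  then show ?thesis by blast
qed

section \<open>The line and the plane\<close>

theorem proposition3p16:
  shows "(subtopology theta_topology (range (\<eta> :: real \<Rightarrow> real set set))
            homeomorphic_space
          subtopology theta_topology (range (\<eta> :: complex \<Rightarrow> complex set set))) \<and>
         ((theta_topology :: real set set topology)
            homeomorphic_space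
          (theta_topology :: complex set set topology))"
proof -
  have "(shell n :: real set) \<approx> (shell n :: complex set)" for n
    using shell_eqpoll_real[OF lepoll_refl, of n] shell_eqpoll_real[OF complex_lepoll_real, of n]
    by (meson eqpoll_sym eqpoll_trans)
  from closed_discrete_iso_of_shells[OF this]
  obtain f :: "real \<Rightarrow> complex" and g where "closed_discrete_iso f g" by blast
  then show ?thesis
    using closed_discrete_iso.range_\<eta>_homeomorphic closed_discrete_iso.theta_homeomorphic by blast
qed

end
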